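(* There exist absolute constants $c,c'>0$ and $n_0$ such that for every $n\ge n_0$ there is a function $f:\{0,1\}^{n^2}\to\{0,1\}$ with $bs(f)\le bs^*(f)\le c\,n$ and $C(f)\ge c'\,n^2$.
   Context: For $x\in\{0,1\}^N$ and $B\subseteq[N]$, $x\oplus B$ is $x$ with the bits in $B$ flipped; a block of $f$ at $x$ is $B$ with $f(x\oplus B)\ne f(x)$. $bs_x(f)$ is the maximum number of pairwise disjoint blocks at $x$; $bs^*_x(f)$ is the maximum of $\sum_B\lambda(B)$ over nonnegative $\lambda$ on blocks at $x$ with $\sum_{B\ni i}\lambda(B)\le1$ for every $i$; $C_x(f)$ is the minimum size of a set $S\subseteq[N]$ meeting every block at $x$. For $m\in\{bs,bs^*,C\}$, $m(f)=\max_x m_x(f)$. *)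

theory Defs
  imports "HOL-Analysis.Analysis"
begin

(* A point of {0,1}^N is a bool list of length N, with [N] rendered as {..<N}.  A function
   {0,1}^N -> {0,1} is a total f :: bool list => bool; every notion below evaluates f only at
   lists of length N, so the values of f elsewhere are irrelevant. *)

definition cube :: "nat \<Rightarrow> bool list set" where
  "cube N = {x. length x = N}"

definition flip :: "bool list \<Rightarrow> nat set \<Rightarrow> bool list" where
  "flip x B = map (\<lambda>i. if i \<in> B then \<not> x ! i else x ! i) [0..<length x]"

definition blocks :: "nat \<Rightarrow> (bool list \<Rightarrow> bool) \<Rightarrow> bool list \<Rightarrow> nat set set" where
  "blocks N f x = {B. B \<subseteq> {..<N} \<and> f (flip x B) \<noteq> f x}"

definition bs_at :: "nat \<Rightarrow> (bool list \<Rightarrow> bool) \<Rightarrow> bool list \<Rightarrow> nat" where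
  "bs_at N f x = Max {card F |F. F \<subseteq> blocks N f x \<and> pairwise disjnt F}"

definition fractional_packing ::
    "nat \<Rightarrow> (bool list \<Rightarrow> bool) \<Rightarrow> bool list \<Rightarrow> (nat set \<Rightarrow> real) \<Rightarrow> bool" where
  "fractional_packing N f x w \<longleftrightarrow>
     (\<forall>B \<in> blocks N f x. 0 \<le> w B) \<and>
     (\<forall>i<N. (\<Sum>B | B \<in> blocks N f x \<and> i \<in> B. w B) \<le> 1)"

(* The supremum is a maximum: see fbs_at_is_max below. *)
definition fbs_at :: "nat \<Rightarrow> (bool list \<Rightarrow> bool) \<Rightarrow> bool list \<Rightarrow> real" where
  "fbs_at N f x = Sup {\<Sum>B \<in> blocks N f x. w B |w. fractional_packing N f x w}"

definition cert_at :: "nat \<Rightarrow> (bool list \<Rightarrow> bool) \<Rightarrow> bool list \<Rightarrow> nat" where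
  "cert_at N f x = Min {card S |S. S \<subseteq> {..<N} \<and> (\<forall>B \<in> blocks N f x. S \<inter> B \<noteq> {})}"

definition block_sensitivity :: "nat \<Rightarrow> (bool list \<Rightarrow> bool) \<Rightarrow> nat" where
  "block_sensitivity N f = Max (bs_at N f ` cube N)"

definition fractional_block_sensitivity :: "nat \<Rightarrow> (bool list \<Rightarrow> bool) \<Rightarrow> real" where
  "fractional_block_sensitivity N f = Max (fbs_at N f ` cube N)"

definition certificate_complexity :: "nat \<Rightarrow> (bool list \<Rightarrow> bool) \<Rightarrow> nat" where
  "certificate_complexity N f = Max (cert_at N f ` cube N)"

lemma finite_cube: "finite (cube N)"
  using finite_lists_length_eq[of "UNIV :: bool set" N] by (simp add: cube_def)

lemma cube_nonempty: "cube N \<noteq> {}"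
  by (auto simp: cube_def intro: exI[of _ "replicate N False"])

lemma finite_blocks: "finite (blocks N f x)"
  by (rule finite_subset[of _ "Pow {..<N}"]) (auto simp: blocks_def)

lemma flip_empty: "flip x {} = x"
  by (simp add: flip_def map_nth)

lemma block_nonempty: "B \<in> blocks N f x \<Longrightarrow> B \<noteq> {}"
  by (auto simp: blocks_def flip_empty)

lemma fractional_packing_le_1:
  assumes "fractional_packing N f x w" "B \<in> blocks N f x"
  shows "w B \<le> 1"
proof -
  obtain i where i: "i \<in> B" "i < N"
    using block_nonempty[OF assms(2)] assms(2) by (auto simp: blocks_def)
  have "w B \<le> (\<Sum>B | B \<in> blocks N f x \<and> i \<in> B. w B)"
    using assms i finite_blocks[of N f x]
    by (intro member_le_sum) (auto simp: fractional_packing_def)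
  also have "\<dots> \<le> 1"
    using assms(1) i by (auto simp: fractional_packing_def)
  finally show ?thesis .
qed

lemma fbs_at_is_max:
  "\<exists>w. fractional_packing N f x w \<and> fbs_at N f x = (\<Sum>B \<in> blocks N f x. w B) \<and>
       (\<forall>v. fractional_packing N f x v \<longrightarrow> (\<Sum>B \<in> blocks N f x. v B) \<le> fbs_at N f x)"
proof -
  let ?Bl = "blocks N f x"
  let ?val = "\<lambda>w :: nat set \<Rightarrow> real. \<Sum>B \<in> ?Bl. w B"
  define K where "K = PiE UNIV (\<lambda>B. if B \<in> ?Bl then {0..1} else {0 :: real})"
  define P where "P = K \<inter> (\<Inter>i\<in>{..<N}. {w. (\<Sum>B | B \<in> ?Bl \<and> i \<in> B. w B) \<le> 1})"
  have "compact K"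
    unfolding K_def compactin_euclidean_iff[symmetric] euclidean_product_topology[symmetric]
    by (subst compactin_PiE) auto
  moreover have "closed (\<Inter>i\<in>{..<N}. {w. (\<Sum>B | B \<in> ?Bl \<and> i \<in> B. w B) \<le> (1 :: real)})"
    by (intro closed_INT ballI closed_Collect_le continuous_on_sum
        continuous_on_product_coordinates continuous_on_const)
  ultimately have "compact P"
    unfolding P_def by (rule compact_Int_closed)
  moreover have "(\<lambda>_. 0) \<in> P"
    by (auto simp: P_def K_def)
  moreover have "continuous_on P ?val"
    by (intro continuous_on_sum continuous_on_subset[OF continuous_on_product_coordinates]) auto
  ultimately obtain w where w: "w \<in> P" "\<And>v. v \<in> P \<Longrightarrow> ?val v \<le> ?val w"
    using continuous_attains_sup[of P ?val] by blast
  have fw: "fractional_packing N f x w"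
    using w(1) by (auto simp: P_def K_def fractional_packing_def PiE_iff split: if_splits)
  have le: "?val v \<le> ?val w" if v: "fractional_packing N f x v" for v
  proof -
    define v' where "v' = (\<lambda>B. if B \<in> ?Bl then v B else 0)"
    have "v' \<in> P"
      using v fractional_packing_le_1[OF v]
      by (auto simp: P_def K_def v'_def fractional_packing_def)
    moreover have "?val v' = ?val v"
      by (auto simp: v'_def)
    ultimately show ?thesis
      using w(2) by metis
  qed
  have "fbs_at N f x = ?val w"
    unfolding fbs_at_def using fw le by (intro cSup_eq_maximum) auto
  then show ?thesis
    using fw le by auto
qed

end

theory Submission
  imports Defs
begin

text \<open>
  Read an input of length $n^2$ as $n$ subsets of $[n]$ and let $f$ accept iff one of them lies
  in a family $A$ whose members are pairwise at Hamming distance greater than $m \approx n/12$.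
  At a rejecting input each of the $n$ subsets has at most one member of $A$ within distance
  $m/2$, so one coordinate of weight $1$ together with the uniform weight $2/(m+1)$ is a
  fractional hitting set of cost $O(1)$ per subset. At an accepting input the $n$ coordinates
  of one accepted subset hit every block. By LP duality the fractional block sensitivity is
  $O(n)$. If moreover every set of size at most $m$ misses some member of $A$, a certificate at
  the zero input needs more than $m$ coordinates in each of the $n$ subsets. Such an $A$ is
  chosen greedily: the number of small sets times the volume of a Hamming ball is less than
  $2^{n-m}$.
\<close>

section \<open>Separated families\<close>

definition hamming_dist :: "'a set \<Rightarrow> 'a set \<Rightarrow> nat" where
  "hamming_dist a b = card (sym_diff a b)"

definition hamming_ball :: "'a set \<Rightarrow> nat \<Rightarrow> 'a set \<Rightarrow> 'a set set" where
  "hamming_ball X m a = {b. b \<subseteq> X \<and> hamming_dist a b \<le> m}"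

definition separated :: "nat \<Rightarrow> 'a set set \<Rightarrow> bool" where
  "separated m A \<longleftrightarrow> (\<forall>a\<in>A. \<forall>b\<in>A. a \<noteq> b \<longrightarrow> m < hamming_dist a b)"

lemma hamming_dist_commute: "hamming_dist a b = hamming_dist b a"
  by (simp add: hamming_dist_def Un_commute)

lemma hamming_dist_triangle:
  assumes "finite a" "finite b" "finite c"
  shows "hamming_dist a c \<le> hamming_dist a b + hamming_dist b c"
proof -
  have "card (sym_diff a c) \<le> card (sym_diff a b \<union> sym_diff b c)"
    using assms by (intro card_mono) auto
  also have "\<dots> \<le> card (sym_diff a b) + card (sym_diff b c)"
    by (rule card_Un_le)
  finally show ?thesis by (simp add: hamming_dist_def)
qed

lemma finite_hamming_ball: "finite X \<Longrightarrow> finite (hamming_ball X m a)"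
  by (rule finite_subset[of _ "Pow X"]) (auto simp: hamming_ball_def)

lemma mem_hamming_ball_empty: "S \<in> hamming_ball X m {} \<longleftrightarrow> S \<subseteq> X \<and> card S \<le> m"
  by (simp add: hamming_ball_def hamming_dist_def)

lemma card_hamming_ball:
  assumes "a \<subseteq> X"
  shows "card (hamming_ball X m a) = card (hamming_ball X m {})"
proof -
  have involution: "sym_diff a (sym_diff a b) = b" for b by blast
  have "bij_betw (sym_diff a) (hamming_ball X m a) (hamming_ball X m {})"
    using assms involution
    by (intro bij_betwI[where g = "sym_diff a"]) (auto simp: hamming_ball_def hamming_dist_def)
  then show ?thesis by (rule bij_betw_same_card)
qed

lemma card_hamming_ball_times_power_le:
  fixes t :: real
  assumes "finite X" "0 \<le> t" "t \<le> 1"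
  shows "real (card (hamming_ball X m {})) * t ^ m \<le> (1 + t) ^ card X"
proof -
  have "real (card (hamming_ball X m {})) * t ^ m = (\<Sum>S\<in>hamming_ball X m {}. t ^ m)"
    by simp
  also have "\<dots> \<le> (\<Sum>S\<in>hamming_ball X m {}. t ^ card S)"
    using assms by (intro sum_mono power_decreasing) (auto simp: mem_hamming_ball_empty)
  also have "\<dots> \<le> (\<Sum>S\<in>Pow X. t ^ card S)"
    using assms by (intro sum_mono2) (auto simp: hamming_ball_def)
  also have "\<dots> = (1 + t) ^ card X"
    using prod_add[OF assms(1), of "\<lambda>_. t" "\<lambda>_. 1"] by (simp add: add.commute)
  finally show ?thesis .
qed

lemma card_hamming_ball_square_less:
  assumes "finite X" "X \<noteq> {}" "12 * m \<le> card X"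
  shows "(card (hamming_ball X m {}))\<^sup>2 < 2 ^ (card X - m)"
proof -
  define V where "V = real (card (hamming_ball X m {}))"
  define n where "n = card X"
  have "n > 0" using assms by (simp add: n_def card_gt_0_iff)
  have "V * (1/8) ^ m \<le> (9/8) ^ n"
    using card_hamming_ball_times_power_le[of X "1/8" m] assms(1) by (simp add: V_def n_def)
  then have "V \<le> (9/8) ^ n * 8 ^ m"
    by (simp add: power_one_over field_simps)
  then have "V\<^sup>2 \<le> ((9/8) ^ n * 8 ^ m)\<^sup>2"
    by (intro power_mono) (auto simp: V_def)
  then have "V\<^sup>2 * 2 ^ m \<le> ((9/8) ^ n * 8 ^ m)\<^sup>2 * 2 ^ m"
    by (intro mult_right_mono) auto
  also have "\<dots> = (81/64) ^ n * 128 ^ m"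
    by (simp add: power2_eq_square mult_ac flip: power_mult_distrib)
  also have "\<dots> \<le> (81/64) ^ n * ((3/2) ^ 12) ^ m"
    by (intro mult_left_mono power_mono) (auto simp: power_divide)
  also have "\<dots> \<le> (81/64) ^ n * (3/2) ^ n"
    using assms(3) by (intro mult_left_mono) (auto simp: n_def simp flip: power_mult)
  also have "\<dots> = (243/128) ^ n"
    by (simp flip: power_mult_distrib)
  also have "\<dots> < 2 ^ n"
    using \<open>n > 0\<close> by (intro power_strict_mono) auto
  also have "\<dots> = 2 ^ (n - m) * 2 ^ m"
    using assms(3) by (simp add: n_def flip: power_add)
  finally have "V\<^sup>2 < 2 ^ (n - m)" by simp
  then have "real ((card (hamming_ball X m {}))\<^sup>2) < real (2 ^ (n - m))"
    by (simp add: V_def)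
  then show ?thesis unfolding n_def by (simp only: of_nat_less_iff)
qed

lemma separated_insert:
  assumes "separated m A" "\<And>a. a \<in> A \<Longrightarrow> m < hamming_dist a b"
  shows "separated m (insert b A)"
  using assms unfolding separated_def by (auto simp: hamming_dist_commute)

lemma separated_near_unique:
  assumes "separated m A" "a \<in> A" "b \<in> A" "finite a" "finite b" "finite c"
    and near: "2 * hamming_dist c a \<le> m" "2 * hamming_dist c b \<le> m"
  shows "a = b"
proof (rule ccontr)
  assume "a \<noteq> b"
  then have "m < hamming_dist a b" using assms by (auto simp: separated_def)
  also have "\<dots> \<le> hamming_dist c a + hamming_dist c b"
    using hamming_dist_triangle[of a c b] assms by (simp add: hamming_dist_commute)
  finally show False using near by linarith
qed

lemma exists_far_set:
  assumes "finite X" "A \<subseteq> Pow X" "U \<subseteq> Pow X"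
    and "card A * card (hamming_ball X m {}) < card U"
  shows "\<exists>b\<in>U. \<forall>a\<in>A. m < hamming_dist a b"
proof -
  have "finite A" using assms(1,2) by (simp add: finite_subset)
  then have "card (\<Union>a\<in>A. hamming_ball X m a) \<le> (\<Sum>a\<in>A. card (hamming_ball X m a))"
    by (rule card_UN_le)
  also have "\<dots> = card A * card (hamming_ball X m {})"
    using \<open>A \<subseteq> Pow X\<close> by (subst sum.cong[OF refl card_hamming_ball]) auto
  also have "\<dots> < card U" by fact
  finally have "\<not> U \<subseteq> (\<Union>a\<in>A. hamming_ball X m a)"
    using \<open>finite A\<close> \<open>finite X\<close> by (meson card_mono finite_UN_I finite_hamming_ball leD)
  then obtain b where b: "b \<in> U" "\<And>a. a \<in> A \<Longrightarrow> b \<notin> hamming_ball X m a" by blast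
  then show ?thesis using \<open>U \<subseteq> Pow X\<close> by (auto simp: hamming_ball_def not_le)
qed

lemma exists_separated_transversal:
  assumes "finite X" "finite \<U>"
    and "\<And>U. U \<in> \<U> \<Longrightarrow> U \<subseteq> Pow X"
    and "\<And>U. U \<in> \<U> \<Longrightarrow> card \<U> * card (hamming_ball X m {}) \<le> card U"
  shows "\<exists>A \<subseteq> \<Union>\<U>. card A \<le> card \<U> \<and> separated m A \<and> (\<forall>U\<in>\<U>. A \<inter> U \<noteq> {})"
  using assms(2-)
proof (induction \<U> rule: finite_induct)
  case empty
  show ?case by (intro exI[of _ "{}"]) (simp add: separated_def)
next
  case (insert U \<U>)
  let ?vol = "card (hamming_ball X m {})"
  have large: "card \<U> * ?vol + ?vol \<le> card U'" if "U' \<in> insert U \<U>" for U'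
    using insert.prems(2)[OF that] insert.hyps by simp
  have "card \<U> * ?vol \<le> card U'" if "U' \<in> \<U>" for U'
    using large[of U'] that by simp
  then obtain A where A: "A \<subseteq> \<Union>\<U>" "card A \<le> card \<U>" "separated m A" "\<forall>U\<in>\<U>. A \<inter> U \<noteq> {}"
    using insert.IH insert.prems(1) by auto
  have "A \<subseteq> Pow X" using A(1) insert.prems(1) by blast
  then have "finite A" using \<open>finite X\<close> by (simp add: finite_subset)
  have "{} \<in> hamming_ball X m {}" by (simp add: mem_hamming_ball_empty)
  then have "0 < ?vol" using \<open>finite X\<close> finite_hamming_ball by (auto simp: card_gt_0_iff)
  have "card A * ?vol \<le> card \<U> * ?vol" using A(2) by simp
  also have "\<dots> < card U" using large[of U] \<open>0 < ?vol\<close> by simp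
  finally obtain b where b: "b \<in> U" "\<And>a. a \<in> A \<Longrightarrow> m < hamming_dist a b"
    using exists_far_set[OF \<open>finite X\<close> \<open>A \<subseteq> Pow X\<close>, of U m] insert.prems(1)[of U] by auto
  have "separated m (insert b A)" using A(3) b(2) by (rule separated_insert)
  moreover have "card (insert b A) \<le> card (insert U \<U>)"
    using A(2) insert.hyps \<open>finite A\<close> by (simp add: card_insert_if)
  ultimately show ?case
    using A b(1) by (intro exI[of _ "insert b A"]) auto
qed

lemma exists_separated_avoiding:
  assumes "finite X" "X \<noteq> {}" "12 * m \<le> card X"
  shows "\<exists>A \<subseteq> Pow X. {} \<notin> A \<and> separated m A \<and>
           (\<forall>S \<subseteq> X. card S \<le> m \<longrightarrow> (\<exists>a\<in>A. a \<inter> S = {}))"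
proof -
  let ?small = "hamming_ball X m {}"
  define avoiding where "avoiding S = Pow (X - S) - {{}}" for S
  define \<U> where "\<U> = avoiding ` ?small"
  have "finite ?small" using \<open>finite X\<close> by (rule finite_hamming_ball)
  have large: "card \<U> * card ?small \<le> card U" if U_in: "U \<in> \<U>" for U
  proof -
    obtain S where "S \<in> ?small" and U: "U = avoiding S" using U_in by (auto simp: \<U>_def)
    then have S: "S \<subseteq> X" "card S \<le> m" by (simp_all add: mem_hamming_ball_empty)
    have "card \<U> * card ?small \<le> (card ?small)\<^sup>2"
      using \<open>finite ?small\<close> by (simp add: \<U>_def power2_eq_square card_image_le mult_le_mono1)
    also have "\<dots> \<le> 2 ^ (card X - m) - 1"
      using card_hamming_ball_square_less[OF assms] by linarith
    also have "\<dots> \<le> 2 ^ card (X - S) - 1"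
      using S \<open>finite X\<close>
      by (intro diff_le_mono power_increasing) (auto simp: card_Diff_subset finite_subset)
    also have "\<dots> = card U"
      using \<open>finite X\<close> by (simp add: U avoiding_def card_Diff_subset card_Pow)
    finally show ?thesis .
  qed
  have "finite \<U>" "\<And>U. U \<in> \<U> \<Longrightarrow> U \<subseteq> Pow X"
    using \<open>finite ?small\<close> by (auto simp: \<U>_def avoiding_def)
  then obtain A where A: "A \<subseteq> \<Union>\<U>" "separated m A" "\<forall>U\<in>\<U>. A \<inter> U \<noteq> {}"
    using exists_separated_transversal[OF \<open>finite X\<close> _ _ large] by blast
  have "\<exists>a\<in>A. a \<inter> S = {}" if "S \<subseteq> X" "card S \<le> m" for S
  proof -
    have "A \<inter> avoiding S \<noteq> {}" using A(3) that by (auto simp: \<U>_def mem_hamming_ball_empty)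
    then show ?thesis by (auto simp: avoiding_def)
  qed
  moreover have "A \<subseteq> Pow X" "{} \<notin> A" using A(1) by (auto simp: \<U>_def avoiding_def)
  ultimately show ?thesis using A(2) by blast
qed

lemma exists_point_hitting_near:
  assumes "finite X" "A \<subseteq> Pow X" "separated m A" "c \<subseteq> X" "c \<notin> A"
  shows "\<exists>p. \<forall>a\<in>A. 2 * hamming_dist c a \<le> m \<longrightarrow> p \<in> sym_diff c a"
proof (cases "\<exists>a\<in>A. 2 * hamming_dist c a \<le> m")
  case True
  then obtain a where a: "a \<in> A" "2 * hamming_dist c a \<le> m" by blast
  then have "sym_diff c a \<noteq> {}" using \<open>c \<notin> A\<close> by auto
  then obtain p where "p \<in> sym_diff c a" by blast
  moreover have "b = a" if "b \<in> A" "2 * hamming_dist c b \<le> m" for b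
    using a that assms
    by (intro separated_near_unique[of m A b a c]) (auto intro: finite_subset)
  ultimately show ?thesis by blast
qed blast

lemma exists_fractional_hitting_weights:
  assumes "finite X" "A \<subseteq> Pow X" "separated m A" "c \<subseteq> X" "c \<notin> A"
  shows "\<exists>z :: 'a \<Rightarrow> real. (\<forall>i. 0 \<le> z i) \<and> (\<forall>a\<in>A. 1 \<le> sum z (sym_diff c a)) \<and>
           sum z X \<le> 1 + 2 * real (card X) / (real m + 1)"
proof -
  have fin: "finite a" if "a \<subseteq> X" for a using that \<open>finite X\<close> by (rule finite_subset)
  obtain p where p: "\<And>a. a \<in> A \<Longrightarrow> 2 * hamming_dist c a \<le> m \<Longrightarrow> p \<in> sym_diff c a"
    using exists_point_hitting_near[OF assms] by blast
  define u where "u = 2 / (real m + 1)"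
  define z where "z i = of_bool (i = p) + u" for i
  have nonneg: "0 \<le> z i" for i by (simp add: z_def u_def)
  have "1 \<le> sum z (sym_diff c a)" if "a \<in> A" for a
  proof (cases "2 * hamming_dist c a \<le> m")
    case True
    have "1 \<le> z p" by (simp add: z_def u_def)
    also have "\<dots> \<le> sum z (sym_diff c a)"
      using p[OF that True] nonneg that assms(2,4) fin by (intro member_le_sum) auto
    finally show ?thesis .
  next
    case False
    then have "real m + 1 \<le> 2 * real (hamming_dist c a)" by linarith
    then have "1 \<le> real (hamming_dist c a) * u" by (simp add: u_def field_simps)
    also have "\<dots> = (\<Sum>i\<in>sym_diff c a. u)" by (simp add: hamming_dist_def)
    also have "\<dots> \<le> sum z (sym_diff c a)" by (intro sum_mono) (simp add: z_def)
    finally show ?thesis .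
  qed
  moreover have "sum z X \<le> 1 + 2 * real (card X) / (real m + 1)"
    using \<open>finite X\<close> by (simp add: z_def u_def sum.distrib of_bool_def mult.commute)
  ultimately show ?thesis using nonneg by blast
qed

section \<open>Bounds on the complexity measures\<close>

definition hitting_set :: "nat \<Rightarrow> (bool list \<Rightarrow> bool) \<Rightarrow> bool list \<Rightarrow> nat set \<Rightarrow> bool" where
  "hitting_set N f x S \<longleftrightarrow> S \<subseteq> {..<N} \<and> (\<forall>B \<in> blocks N f x. S \<inter> B \<noteq> {})"

definition fractional_hitting_set ::
    "nat \<Rightarrow> (bool list \<Rightarrow> bool) \<Rightarrow> bool list \<Rightarrow> (nat \<Rightarrow> real) \<Rightarrow> bool" where
  "fractional_hitting_set N f x z \<longleftrightarrow>
     (\<forall>i<N. 0 \<le> z i) \<and> (\<forall>B \<in> blocks N f x. 1 \<le> sum z B)"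

lemma finite_block: "B \<in> blocks N f x \<Longrightarrow> finite B"
  by (auto simp: blocks_def intro: finite_subset)

lemma fbs_at_le_sum_fractional_hitting_set:
  assumes z: "fractional_hitting_set N f x z"
  shows "fbs_at N f x \<le> (\<Sum>i<N. z i)"
proof -
  let ?blocks = "blocks N f x"
  obtain w where w: "fractional_packing N f x w" "fbs_at N f x = (\<Sum>B\<in>?blocks. w B)"
    using fbs_at_is_max by blast
  have "(\<Sum>B\<in>?blocks. w B) \<le> (\<Sum>B\<in>?blocks. w B * sum z B)"
    using w(1) z
    by (intro sum_mono)
      (fastforce simp: fractional_packing_def fractional_hitting_set_def mult_le_cancel_left1)
  also have "\<dots> = (\<Sum>B\<in>?blocks. \<Sum>i | i \<in> {..<N} \<and> i \<in> B. w B * z i)"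
    by (intro sum.cong) (auto simp: sum_distrib_left blocks_def intro!: sum.cong)
  also have "\<dots> = (\<Sum>i<N. \<Sum>B | B \<in> ?blocks \<and> i \<in> B. w B * z i)"
    by (intro sum.swap_restrict finite_blocks finite_lessThan)
  also have "\<dots> = (\<Sum>i<N. (\<Sum>B | B \<in> ?blocks \<and> i \<in> B. w B) * z i)"
    by (simp add: sum_distrib_right)
  also have "\<dots> \<le> (\<Sum>i<N. 1 * z i)"
    using w(1) z by (intro sum_mono mult_right_mono)
      (auto simp: fractional_packing_def fractional_hitting_set_def)
  finally show ?thesis using w(2) by simp
qed

lemma fractional_hitting_set_of_bool:
  assumes "hitting_set N f x S"
  shows "fractional_hitting_set N f x (\<lambda>i. of_bool (i \<in> S))"
  unfolding fractional_hitting_set_def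
proof (intro conjI ballI allI impI)
  fix B assume B: "B \<in> blocks N f x"
  then have "B \<inter> S \<noteq> {}" using assms by (auto simp: hitting_set_def)
  then have "1 \<le> card (B \<inter> S)" using finite_block[OF B] by (simp add: Suc_le_eq card_gt_0_iff)
  then show "1 \<le> (\<Sum>i\<in>B. of_bool (i \<in> S) :: real)" using finite_block[OF B] by simp
qed simp

lemma fbs_at_le_card_hitting_set:
  assumes "hitting_set N f x S"
  shows "fbs_at N f x \<le> real (card S)"
proof -
  have "fbs_at N f x \<le> (\<Sum>i<N. of_bool (i \<in> S))"
    using assms by (intro fbs_at_le_sum_fractional_hitting_set fractional_hitting_set_of_bool)
  also have "\<dots> = real (card S)"
    using assms by (simp add: hitting_set_def Int_absorb1)
  finally show ?thesis .
qed

lemma fractional_packing_of_bool: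
  assumes F: "F \<subseteq> blocks N f x" "pairwise disjnt F"
  shows "fractional_packing N f x (\<lambda>B. of_bool (B \<in> F))"
  unfolding fractional_packing_def
proof (intro conjI ballI allI impI)
  fix i
  let ?Bi = "{B. B \<in> blocks N f x \<and> i \<in> B}"
  have "finite (?Bi \<inter> F)" using finite_blocks by simp
  then have "card (?Bi \<inter> F) \<le> 1"
    using F(2) by (auto simp: card_le_Suc0_iff_eq pairwise_def disjnt_def)
  then show "(\<Sum>B\<in>?Bi. of_bool (B \<in> F)) \<le> (1 :: real)"
    using finite_blocks by simp
qed simp

lemma bs_at_attained: "\<exists>F \<subseteq> blocks N f x. pairwise disjnt F \<and> bs_at N f x = card F"
proof -
  let ?sizes = "{card F |F. F \<subseteq> blocks N f x \<and> pairwise disjnt F}"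
  have "?sizes \<subseteq> card ` Pow (blocks N f x)" by auto
  then have "finite ?sizes" by (rule finite_subset) (simp add: finite_blocks)
  moreover have "?sizes \<noteq> {}" by (auto intro!: exI[of _ "{}"])
  ultimately have "bs_at N f x \<in> ?sizes" unfolding bs_at_def by (rule Max_in)
  then show ?thesis by auto
qed

lemma bs_at_le_fbs_at: "real (bs_at N f x) \<le> fbs_at N f x"
proof -
  obtain F where F: "F \<subseteq> blocks N f x" "pairwise disjnt F" "bs_at N f x = card F"
    using bs_at_attained by blast
  have "real (card F) = (\<Sum>B\<in>blocks N f x. of_bool (B \<in> F))"
    using F(1) by (simp add: finite_blocks Int_absorb1)
  also have "\<dots> \<le> fbs_at N f x"
    using fbs_at_is_max fractional_packing_of_bool[OF F(1,2)] by blast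
  finally show ?thesis by (simp add: F(3))
qed

lemma cert_at_attained: "\<exists>S. hitting_set N f x S \<and> cert_at N f x = card S"
proof -
  let ?sizes = "{card S |S. hitting_set N f x S}"
  have "?sizes \<subseteq> card ` Pow {..<N}" by (auto simp: hitting_set_def)
  then have "finite ?sizes" by (rule finite_subset) simp
  moreover have "{..<N} \<inter> B = B" "B \<noteq> {}" if "B \<in> blocks N f x" for B
    using that block_nonempty by (auto simp: blocks_def)
  then have "hitting_set N f x {..<N}" by (simp add: hitting_set_def)
  then have "?sizes \<noteq> {}" by blast
  ultimately have "Min ?sizes \<in> ?sizes" by (rule Min_in)
  then show ?thesis by (auto simp: cert_at_def hitting_set_def)
qed

lemma fractional_block_sensitivity_le_iff:
  "fractional_block_sensitivity N f \<le> b \<longleftrightarrow> (\<forall>x\<in>cube N. fbs_at N f x \<le> b)"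
  using finite_cube cube_nonempty by (simp add: fractional_block_sensitivity_def)

lemma block_sensitivity_le_fractional:
  "real (block_sensitivity N f) \<le> fractional_block_sensitivity N f"
proof -
  have "block_sensitivity N f \<in> bs_at N f ` cube N"
    unfolding block_sensitivity_def using finite_cube cube_nonempty by (intro Max_in) auto
  then obtain x where x: "x \<in> cube N" "block_sensitivity N f = bs_at N f x" by auto
  have "fbs_at N f x \<le> fractional_block_sensitivity N f"
    using x(1) fractional_block_sensitivity_le_iff by blast
  then show ?thesis using bs_at_le_fbs_at[of N f x] x(2) by simp
qed

lemma le_certificate_complexity:
  assumes "x \<in> cube N" "\<And>S. hitting_set N f x S \<Longrightarrow> k \<le> card S"
  shows "k \<le> certificate_complexity N f"
proof -
  have "k \<le> cert_at N f x" using cert_at_attained assms(2) by metis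
  also have "\<dots> \<le> certificate_complexity N f"
    unfolding certificate_complexity_def using finite_cube assms(1) by (intro Max_ge) auto
  finally show ?thesis .
qed

section \<open>Functions accepting a row of the input\<close>

definition support :: "bool list \<Rightarrow> nat set" where
  "support x = {i. i < length x \<and> x ! i}"

definition nth_row :: "nat \<Rightarrow> nat \<Rightarrow> nat set \<Rightarrow> nat set" where
  "nth_row n j S = {i. i < n \<and> j * n + i \<in> S}"

definition some_row_in :: "nat \<Rightarrow> nat \<Rightarrow> nat set set \<Rightarrow> bool list \<Rightarrow> bool" where
  "some_row_in r n A x \<longleftrightarrow> (\<exists>j<r. nth_row n j (support x) \<in> A)"

lemma support_flip: "B \<subseteq> {..<length x} \<Longrightarrow> support (flip x B) = sym_diff (support x) B"
  by (auto simp: support_def flip_def)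

lemma nth_row_sym_diff: "nth_row n j (sym_diff S B) = sym_diff (nth_row n j S) (nth_row n j B)"
  by (auto simp: nth_row_def)

lemma nth_row_subset: "nth_row n j S \<subseteq> {..<n}"
  by (auto simp: nth_row_def)

lemma nth_row_image: "a \<subseteq> {..<n} \<Longrightarrow> nth_row n j ((+) (j * n) ` a) = a"
  by (auto simp: nth_row_def)

lemma some_row_in_flip:
  assumes "B \<subseteq> {..<length x}"
  shows "some_row_in r n A (flip x B) \<longleftrightarrow>
    (\<exists>j<r. sym_diff (nth_row n j (support x)) (nth_row n j B) \<in> A)"
  using assms by (simp add: some_row_in_def support_flip nth_row_sym_diff)

lemma row_index_less:
  fixes i j n r :: nat
  assumes "j < r" "i < n"
  shows "j * n + i < r * n"
proof -
  have "j * n + i < (j + 1) * n" using assms by simp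
  also have "\<dots> \<le> r * n" using assms by (intro mult_right_mono) auto
  finally show ?thesis .
qed

lemma sum_over_rows:
  assumes "S \<subseteq> {..<r * n}"
  shows "sum z S = (\<Sum>j<r. \<Sum>i\<in>nth_row n j S. z (j * n + i))"
proof -
  have "sum z S = (\<Sum>k<r * n. if k \<in> S then z k else 0)"
    using assms by (simp add: Int_absorb1 flip: sum.inter_restrict)
  also have "\<dots> = (\<Sum>j<r. \<Sum>i<n. if j * n + i \<in> S then z (j * n + i) else 0)"
    by (simp add: sum_mult_product add.commute[of "_ * n"] cong: if_cong)
  also have "\<dots> = (\<Sum>j<r. \<Sum>i\<in>nth_row n j S. z (j * n + i))"
    by (simp add: nth_row_def flip: sum.inter_filter)
  finally show ?thesis .
qed

lemma hitting_set_accepting_row: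
  assumes x: "length x = r * n" and j: "j < r" "nth_row n j (support x) \<in> A"
  shows "hitting_set (r * n) (some_row_in r n A) x ((+) (j * n) ` {..<n})"
  unfolding hitting_set_def
proof (intro conjI ballI)
  show "(+) (j * n) ` {..<n} \<subseteq> {..<r * n}"
    using j(1) by (auto intro: row_index_less)
  fix B assume "B \<in> blocks (r * n) (some_row_in r n A) x"
  moreover have "some_row_in r n A x" using j by (auto simp: some_row_in_def)
  ultimately have "sym_diff (nth_row n j (support x)) (nth_row n j B) \<notin> A"
    using x j(1) by (auto simp: blocks_def some_row_in_flip)
  then have "nth_row n j B \<noteq> {}" using j(2) by auto
  then show "(+) (j * n) ` {..<n} \<inter> B \<noteq> {}" by (auto simp: nth_row_def)
qed

lemma fbs_at_accepting_le:
  assumes "length x = r * n" "some_row_in r n A x"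
  shows "fbs_at (r * n) (some_row_in r n A) x \<le> real n"
proof -
  obtain j where "j < r" "nth_row n j (support x) \<in> A"
    using assms(2) by (auto simp: some_row_in_def)
  then have "fbs_at (r * n) (some_row_in r n A) x \<le> real (card ((+) (j * n) ` {..<n}))"
    using assms(1) by (intro fbs_at_le_card_hitting_set hitting_set_accepting_row)
  then show ?thesis by (simp add: card_image)
qed

lemma fractional_hitting_set_rows:
  assumes x: "length x = r * n"
    and nonneg: "\<And>j i. j < r \<Longrightarrow> 0 \<le> z j i"
    and hit: "\<And>j a. j < r \<Longrightarrow> a \<in> A \<Longrightarrow> 1 \<le> sum (z j) (sym_diff (nth_row n j (support x)) a)"
  shows "fractional_hitting_set (r * n) (some_row_in r n A) x (\<lambda>k. z (k div n) (k mod n))"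
    (is "fractional_hitting_set _ _ _ ?z")
  unfolding fractional_hitting_set_def
proof (intro conjI allI ballI impI)
  show "0 \<le> ?z k" if "k < r * n" for k
    using that by (intro nonneg less_mult_imp_div_less)
  fix B assume B: "B \<in> blocks (r * n) (some_row_in r n A) x"
  have "\<not> some_row_in r n A x"
    using hit by (fastforce simp: some_row_in_def)
  then obtain j where j: "j < r" "sym_diff (nth_row n j (support x)) (nth_row n j B) \<in> A"
    using B x by (auto simp: blocks_def some_row_in_flip)
  have B_sub: "B \<subseteq> {..<r * n}" using B by (simp add: blocks_def)
  have "1 \<le> sum (z j) (nth_row n j B)"
  proof -
    have "sym_diff c (sym_diff c b) = b" for c b :: "nat set" by blast
    then show ?thesis using hit[OF j] by simp
  qed
  also have "\<dots> = (\<Sum>i\<in>nth_row n j B. ?z (j * n + i))"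
    by (intro sum.cong) (auto simp: nth_row_def)
  also have "\<dots> \<le> (\<Sum>j<r. \<Sum>i\<in>nth_row n j B. ?z (j * n + i))"
    using j(1) nonneg
    by (intro member_le_sum[of j "{..<r}" "\<lambda>j. \<Sum>i\<in>nth_row n j B. ?z (j * n + i)"] sum_nonneg)
      (auto simp: nth_row_def)
  also have "\<dots> = sum ?z B" using B_sub by (rule sum_over_rows[symmetric])
  finally show "1 \<le> sum ?z B" .
qed

lemma fbs_at_rejecting_le:
  assumes A: "A \<subseteq> Pow {..<n}" "separated m A"
    and x: "length x = r * n" and rejecting: "\<not> some_row_in r n A x"
  shows "fbs_at (r * n) (some_row_in r n A) x \<le> real r * (1 + 2 * real n / (real m + 1))"
proof -
  let ?c = "\<lambda>j. nth_row n j (support x)"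
  have "\<exists>z :: nat \<Rightarrow> real. (\<forall>i. 0 \<le> z i) \<and> (\<forall>a\<in>A. 1 \<le> sum z (sym_diff (?c j) a)) \<and>
      sum z {..<n} \<le> 1 + 2 * real n / (real m + 1)" if "j < r" for j
    using exists_fractional_hitting_weights[OF _ A nth_row_subset, of j "support x"] that rejecting
    by (auto simp: some_row_in_def)
  then obtain z :: "nat \<Rightarrow> nat \<Rightarrow> real" where nonneg: "\<And>j i. j < r \<Longrightarrow> 0 \<le> z j i"
    and hit: "\<And>j a. j < r \<Longrightarrow> a \<in> A \<Longrightarrow> 1 \<le> sum (z j) (sym_diff (?c j) a)"
    and cost: "\<And>j. j < r \<Longrightarrow> sum (z j) {..<n} \<le> 1 + 2 * real n / (real m + 1)"
    by metis
  have "fbs_at (r * n) (some_row_in r n A) x \<le> (\<Sum>k<r * n. z (k div n) (k mod n))"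
    using x nonneg hit
    by (intro fbs_at_le_sum_fractional_hitting_set fractional_hitting_set_rows)
  also have "\<dots> = (\<Sum>j<r. sum (z j) {..<n})"
    by (simp add: sum_mult_product)
  also have "\<dots> \<le> real r * (1 + 2 * real n / (real m + 1))"
    using sum_bounded_above[of "{..<r}" "\<lambda>j. sum (z j) {..<n}", OF cost] by simp
  finally show ?thesis .
qed

lemma fractional_block_sensitivity_some_row_in_le:
  assumes "A \<subseteq> Pow {..<n}" "separated m A"
  shows "fractional_block_sensitivity (r * n) (some_row_in r n A)
    \<le> max (real n) (real r * (1 + 2 * real n / (real m + 1)))"
  unfolding fractional_block_sensitivity_le_iff
proof
  fix x assume "x \<in> cube (r * n)"
  then have x: "length x = r * n" by (simp add: cube_def)
  show "fbs_at (r * n) (some_row_in r n A) x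
    \<le> max (real n) (real r * (1 + 2 * real n / (real m + 1)))"
    using fbs_at_accepting_le[OF x] fbs_at_rejecting_le[OF assms x]
    by (cases "some_row_in r n A x") (simp_all add: le_max_iff_disj)
qed

lemma row_image_in_blocks_zero:
  assumes "A \<subseteq> Pow {..<n}" "{} \<notin> A" "j < r" "a \<in> A"
  shows "(+) (j * n) ` a \<in> blocks (r * n) (some_row_in r n A) (replicate (r * n) False)"
proof -
  let ?zero = "replicate (r * n) False"
  have a: "a \<subseteq> {..<n}" using assms by blast
  then have sub: "(+) (j * n) ` a \<subseteq> {..<r * n}" using assms(3) by (auto intro: row_index_less)
  have zero: "nth_row n k (support ?zero) = {}" for k by (auto simp: support_def nth_row_def)
  then have "\<not> some_row_in r n A ?zero" using assms(2) by (simp add: some_row_in_def)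
  moreover have "some_row_in r n A (flip ?zero ((+) (j * n) ` a))"
    using sub assms(3,4) nth_row_image[OF a, of j] by (auto simp: some_row_in_flip zero)
  ultimately show ?thesis using sub by (simp add: blocks_def)
qed

lemma certificate_complexity_some_row_in_ge:
  assumes A: "A \<subseteq> Pow {..<n}" "{} \<notin> A"
    and avoiding: "\<And>S. S \<subseteq> {..<n} \<Longrightarrow> card S \<le> m \<Longrightarrow> \<exists>a\<in>A. a \<inter> S = {}"
  shows "r * (m + 1) \<le> certificate_complexity (r * n) (some_row_in r n A)"
proof (rule le_certificate_complexity)
  let ?zero = "replicate (r * n) False"
  show "?zero \<in> cube (r * n)" by (simp add: cube_def)
  fix S assume S: "hitting_set (r * n) (some_row_in r n A) ?zero S"
  have "m + 1 \<le> card (nth_row n j S)" if "j < r" for j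
  proof (rule ccontr)
    assume "\<not> m + 1 \<le> card (nth_row n j S)"
    then obtain a where a: "a \<in> A" "a \<inter> nth_row n j S = {}"
      using avoiding nth_row_subset by (metis Suc_eq_plus1 not_less_eq_eq)
    then have "S \<inter> (+) (j * n) ` a \<noteq> {}"
      using S row_image_in_blocks_zero[OF A that] by (simp add: hitting_set_def)
    then show False using a A(1) by (auto simp: nth_row_def)
  qed
  then have "r * (m + 1) \<le> (\<Sum>j<r. card (nth_row n j S))"
    using sum_bounded_below[of "{..<r}" "m + 1"] by simp
  also have "\<dots> = card S"
    using S sum_over_rows[of S r n "\<lambda>_. 1 :: nat"] by (simp add: hitting_set_def)
  finally show "r * (m + 1) \<le> card S" .
qed

theorem mainTheorem4:
  shows "\<exists>(c :: real) (c' :: real) (n0 :: nat). c > 0 \<and> c' > 0 \<and>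
    (\<forall>n \<ge> n0. \<exists>f :: bool list \<Rightarrow> bool.
       real (block_sensitivity (n\<^sup>2) f) \<le> fractional_block_sensitivity (n\<^sup>2) f \<and>
       fractional_block_sensitivity (n\<^sup>2) f \<le> c * real n \<and>
       real (certificate_complexity (n\<^sup>2) f) \<ge> c' * (real n)\<^sup>2)"
proof (rule exI[of _ 25], rule exI[of _ "1/12"], rule exI[of _ 1], intro conjI allI impI)
  fix n :: nat assume "n \<ge> 1"
  define m where "m = n div 12"
  have "real n \<le> real (12 * (m + 1))" unfolding m_def of_nat_le_iff by presburger
  then have m: "real n \<le> 12 * (real m + 1)" by simp
  obtain A where A: "A \<subseteq> Pow {..<n}" "{} \<notin> A" "separated m A"
    "\<And>S. S \<subseteq> {..<n} \<Longrightarrow> card S \<le> m \<Longrightarrow> \<exists>a\<in>A. a \<inter> S = {}"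
    using exists_separated_avoiding[of "{..<n}" m] \<open>n \<ge> 1\<close> by (auto simp: m_def lessThan_empty_iff)
  have "fractional_block_sensitivity (n\<^sup>2) (some_row_in n n A)
      \<le> max (real n) (real n * (1 + 2 * real n / (real m + 1)))"
    unfolding power2_eq_square using A(1,3) by (rule fractional_block_sensitivity_some_row_in_le)
  also have "\<dots> \<le> max (real n) (real n * (1 + 24))"
    using m by (intro max.mono mult_left_mono add_left_mono) (auto simp: pos_divide_le_eq)
  finally have "fractional_block_sensitivity (n\<^sup>2) (some_row_in n n A) \<le> 25 * real n" by simp
  moreover have "1/12 * (real n)\<^sup>2 \<le> real (n * (m + 1))"
    using mult_left_mono[OF m, of "real n"] by (simp add: power2_eq_square algebra_simps)
  moreover have "n * (m + 1) \<le> certificate_complexity (n\<^sup>2) (some_row_in n n A)"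
    unfolding power2_eq_square using A(1,2,4) by (rule certificate_complexity_some_row_in_ge)
  ultimately show "\<exists>f. real (block_sensitivity (n\<^sup>2) f) \<le> fractional_block_sensitivity (n\<^sup>2) f \<and>
      fractional_block_sensitivity (n\<^sup>2) f \<le> 25 * real n \<and>
      1/12 * (real n)\<^sup>2 \<le> real (certificate_complexity (n\<^sup>2) f)"
    using block_sensitivity_le_fractional by (meson of_nat_mono order_trans)
qed simp_all

end
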